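(* Let $n_1,\dots,n_r$ and $k_1,\dots,k_u$ be positive integers and put $f(s,t)=\prod_{i=1}^r \{n_i\}$ and $g(s,t)=\prod_{j=1}^u \{k_j\}$. Write their atomic decompositions as $$f(s,t)=\prod_{d\ge 2} P_d(s,t)^{a_d},\qquad g(s,t)=\prod_{d\ge2}P_d(s,t)^{b_d},$$ where $a_d$ is the number of indices $i$ with $d\mid n_i$ and $b_d$ is the number of indices $j$ with $d\mid k_j$. Then $f(s,t)/g(s,t)$ is a polynomial if and only if $a_d\ge b_d$ for all $d\ge 2$. Furthermore, in this case $f(s,t)/g(s,t)$ has nonnegative integer coefficients, i.e. lies in $\mathbb{N}[s,t]$.
   Context: Let $s,t$ be variables. The Lucas polynomials are defined by $\{0\}=0$, $\{1\}=1$ and $\{n\}=s\{n-1\}+t\{n-2\}$ for $n\ge2$. Let $\Phi_n(q)=\prod_\zeta (q-\zeta)$ be the $n$th cyclotomic polynomial (product over primitive $n$th roots of unity) and $\phi$ the Euler totient function. For $n\ge 2$, $\Phi_n(q)$ is palindromic of degree $\phi(n)$ with constant term $1$ (i.e. $q^{\phi(n)}\Phi_n(1/q)=\Phi_n(q)$), so there are unique complex numbers $\gamma_j$ with $\Phi_n(q)=\sum_{0\le j\le \phi(n)/2}\gamma_j q^j(1+q)^{\phi(n)-2j}$. The $n$th Lucas atom is $P_n(s,t)=\sum_j \gamma_j s^{\phi(n)-2j}(-t)^j$ for $n\ge2$, and $P_1(s,t)=1$. One has $\{n\}=\prod_{d\mid n}P_d(s,t)$ for $n\ge1$; the atomic decomposition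 of a product $\prod_i\{n_i\}$ is the product of Lucas atoms obtained by replacing each $\{n_i\}$ by $\prod_{d\mid n_i}P_d(s,t)$. $\mathbb{N}$ denotes the nonnegative integers. *)

theory Defs
  imports
    Complex_Main
    "HOL-Computational_Algebra.Polynomial_Factorial"
    "HOL-Number_Theory.Totient"
begin

text \<open>
  A polynomial in \<open>s, t\<close> is a polynomial in \<open>s\<close> whose coefficients are polynomials in \<open>t\<close>:
  the coefficient of \<open>s\<^sup>i t\<^sup>j\<close> in \<open>p\<close> is \<open>coeff (coeff p i) j\<close>. The base ring is the field of
  complex numbers, because the numbers \<open>\<gamma>\<^sub>j\<close> below are introduced as complex numbers.
\<close>

type_synonym bipoly = "complex poly poly"

definition var_s :: bipoly where
  "var_s = [:0, 1:]"

definition var_t :: bipoly where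
  "var_t = [:[:0, 1:]:]"

definition nonneg_integer_coeffs :: "bipoly \<Rightarrow> bool" where
  "nonneg_integer_coeffs p \<longleftrightarrow> (\<forall>i j. coeff (coeff p i) j \<in> \<nat>)"

fun lucas :: "nat \<Rightarrow> bipoly" where
  "lucas 0 = 0"
| "lucas (Suc 0) = 1"
| "lucas (Suc (Suc n)) = var_s * lucas (Suc n) + var_t * lucas n"

definition primitive_roots :: "nat \<Rightarrow> complex set" where
  "primitive_roots n = {z. z ^ n = 1 \<and> (\<forall>m\<in>{1..<n}. z ^ m \<noteq> 1)}"

definition cyclotomic :: "nat \<Rightarrow> complex poly" where
  "cyclotomic n = (\<Prod>z\<in>primitive_roots n. [:- z, 1:])"

text \<open>
  The coefficients \<open>\<gamma>\<^sub>j\<close> exist and are unique for \<open>0 \<le> j \<le> \<phi>(n)/2\<close> when \<open>n \<ge> 2\<close>. The first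
  conjunct only fixes the values of the total function \<open>\<gamma>\<close> outside that range, so that \<open>THE\<close>
  denotes a unique function; for \<open>n < 2\<close> the definition is not used.
\<close>

definition gamma_coeff :: "nat \<Rightarrow> nat \<Rightarrow> complex" where
  "gamma_coeff n = (THE \<gamma>. (\<forall>j. totient n div 2 < j \<longrightarrow> \<gamma> j = 0) \<and>
     cyclotomic n =
       (\<Sum>j\<le>totient n div 2. smult (\<gamma> j) ([:0, 1:] ^ j * [:1, 1:] ^ (totient n - 2 * j))))"

definition lucas_atom :: "nat \<Rightarrow> bipoly" where
  "lucas_atom n =
     (if n < 2 then 1
      else \<Sum>j\<le>totient n div 2.
        smult [:gamma_coeff n j:] (var_s ^ (totient n - 2 * j) * (- var_t) ^ j))"

end

theory Submission
  imports Defs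
begin

text \<open>
  For \<open>n \<ge> 3\<close> the primitive roots come in conjugate pairs, and a pair \<open>z, cnj z\<close> contributes the
  factor \<open>(1 + q)\<^sup>2 - (2 + 2 Re z) q\<close> to \<open>\<Phi>\<^sub>n\<close>. Hence \<open>P\<^sub>n\<close> is the product of the polynomials
  \<open>s\<^sup>2 + (2 + 2 Re z) t\<close>, whose coefficients are nonnegative reals. Under \<open>s = x + y\<close>, \<open>t = - x y\<close> the
  polynomial \<open>{n}\<close> becomes \<open>(x\<^sup>n - y\<^sup>n) / (x - y)\<close> and \<open>P\<^sub>n\<close> becomes the product of \<open>x - z y\<close> over the
  primitive roots \<open>z\<close>, which gives the atomic decomposition. As \<open>P\<^sub>n\<close> is monic in \<open>s\<close> and \<open>{n}\<close> is
  integral, induction on \<open>n\<close> makes \<open>P\<^sub>n\<close> integral as well, so its coefficients are in \<open>\<nat>\<close>.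

  Conversely, fix a primitive \<open>d\<close>th root of unity \<open>z\<close> and put \<open>t = - z\<close>. Then \<open>P\<^sub>e\<close> vanishes at
  \<open>s = z + 1\<close> exactly for \<open>e = d\<close>, so the order of vanishing at that point compares the exponents
  of \<open>P\<^sub>d\<close> in \<open>f\<close> and \<open>g\<close>.
\<close>

subsection \<open>Polynomials with coefficients in a subsemiring\<close>

text \<open>Subtraction is left out so that one notion serves for \<open>\<int>\<close>,
  \<open>\<nat>\<close> and the nonnegative reals inside the complex numbers.\<close>

definition subsemiring :: "'a::comm_semiring_1 set \<Rightarrow> bool" where
  "subsemiring R \<longleftrightarrow> 0 \<in> R \<and> 1 \<in> R \<and> (\<forall>x\<in>R. \<forall>y\<in>R. x + y \<in> R \<and> x * y \<in> R)"

text \<open>Applied twice, as in \<open>coeffs_in (coeffs_in R)\<close>, this constrains every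
  coefficient of a \<open>bipoly\<close>.\<close>

definition coeffs_in :: "'a::zero set \<Rightarrow> 'a poly set" where
  "coeffs_in R = {p. \<forall>i. coeff p i \<in> R}"

lemma coeffs_inD: "p \<in> coeffs_in R \<Longrightarrow> coeff p i \<in> R"
  by (simp add: coeffs_in_def)

lemma subsemiring_sum:
  assumes "subsemiring R" "\<And>x. x \<in> A \<Longrightarrow> h x \<in> R"
  shows "sum h A \<in> R"
  using assms(2) by (induction A rule: infinite_finite_induct)
    (use assms(1) in \<open>auto simp: subsemiring_def\<close>)

lemma subsemiring_prod:
  assumes "subsemiring R" "\<And>x. x \<in> A \<Longrightarrow> h x \<in> R"
  shows "prod h A \<in> R"
  using assms(2) by (induction A rule: infinite_finite_induct)
    (use assms(1) in \<open>auto simp: subsemiring_def\<close>)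

lemma subsemiring_power: "subsemiring R \<Longrightarrow> x \<in> R \<Longrightarrow> x ^ m \<in> R"
  by (induction m) (auto simp: subsemiring_def)

lemma subsemiring_coeffs_in:
  assumes "subsemiring R"
  shows "subsemiring (coeffs_in R)"
proof -
  have "p * q \<in> coeffs_in R" if "p \<in> coeffs_in R" "q \<in> coeffs_in R" for p q
    using that assms unfolding coeffs_in_def mem_Collect_eq coeff_mult
    by (intro allI subsemiring_sum[OF assms]) (simp add: subsemiring_def)
  moreover have "coeff 1 i \<in> R" for i
    using assms by (simp add: coeff_1 subsemiring_def)
  ultimately show ?thesis
    using assms by (auto simp: subsemiring_def coeffs_in_def)
qed

lemma monom_in_coeffs_in: "0 \<in> R \<Longrightarrow> c \<in> R \<Longrightarrow> monom c i \<in> coeffs_in R"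
  by (auto simp: coeffs_in_def coeff_monom)

lemma subsemiring_Ints: "subsemiring (\<int> :: 'a::comm_ring_1 set)"
  by (auto simp: subsemiring_def)

lemma subsemiring_Nats: "subsemiring (\<nat> :: 'a::comm_semiring_1 set)"
  by (auto simp: subsemiring_def)

lemma subsemiring_nonneg: "subsemiring (of_real ` {0..} :: 'a::{real_algebra_1, comm_ring_1} set)"
  unfolding subsemiring_def
proof (intro conjI ballI)
  fix x y :: 'a assume "x \<in> of_real ` {0..}" "y \<in> of_real ` {0..}"
  then obtain r s where "x = of_real r" "y = of_real s" "0 \<le> r" "0 \<le> s" by auto
  then show "x + y \<in> of_real ` {0..}" "x * y \<in> of_real ` {0..}"
    by (simp_all flip: of_real_add of_real_mult)
qed (auto intro!: image_eqI[of _ _ 0] image_eqI[of _ _ 1])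

text \<open>Long division by a monic polynomial: \<open>B * C\<close> and \<open>C\<close> share
  their leading coefficient, so the leading term \<open>M\<close> of \<open>C\<close> is admissible,
  and subtracting \<open>B * M\<close> leaves a problem of smaller degree.\<close>

lemma monic_quotient_coeffs_in:
  fixes B C :: "'a::idom poly"
  assumes "subsemiring R" and diff: "\<And>x y. x \<in> R \<Longrightarrow> y \<in> R \<Longrightarrow> x - y \<in> R"
    and "lead_coeff B = 1" "B \<in> coeffs_in R" "B * C \<in> coeffs_in R"
  shows "C \<in> coeffs_in R"
  using assms(5)
proof (induction "degree C" arbitrary: C rule: less_induct)
  case less
  have zero: "0 \<in> R" using assms(1) by (simp add: subsemiring_def)
  define M where "M = monom (lead_coeff C) (degree C)"
  have "lead_coeff (B * C) = lead_coeff C"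
    by (simp only: lead_coeff_mult assms(3) mult_1)
  then have lc: "lead_coeff C \<in> R"
    using less.prems by (metis coeffs_inD)
  then have M: "M \<in> coeffs_in R"
    unfolding M_def by (intro monom_in_coeffs_in zero)
  show ?case
  proof (cases "degree C = 0")
    case True
    then have "C = M" unfolding M_def by (metis coeff_pCons_0 degree_eq_zeroE monom_0)
    with M show ?thesis by simp
  next
    case False
    have "degree (C - M) < degree C"
    proof (rule degree_lessI)
      show "C - M \<noteq> 0 \<or> degree C > 0" using False by simp
      show "\<forall>k\<ge>degree C. coeff (C - M) k = 0"
        by (auto simp: M_def coeff_monom coeff_eq_0)
    qed
    moreover have "B * (C - M) \<in> coeffs_in R"
    proof -
      have "B * M \<in> coeffs_in R"
        using subsemiring_coeffs_in[OF assms(1)] assms(4) M by (simp add: subsemiring_def)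
      then show ?thesis
        using less.prems diff by (simp add: coeffs_in_def right_diff_distrib)
    qed
    ultimately have "C - M \<in> coeffs_in R" by (rule less.hyps)
    then have "C - M + M \<in> coeffs_in R"
      using subsemiring_coeffs_in[OF assms(1)] M unfolding subsemiring_def by blast
    then show ?thesis by simp
  qed
qed

subsection \<open>Primitive roots of unity and cyclotomic polynomials\<close>

lemma finite_primitive_roots:
  assumes "n > 0" shows "finite (primitive_roots n)"
  by (rule finite_subset[OF _ finite_roots_unity[of n]]) (use assms in \<open>auto simp: primitive_roots_def\<close>)

lemma primitive_roots_unique:
  assumes "z \<in> primitive_roots d" "z \<in> primitive_roots e" "d > 0" "e > 0"
  shows "d = e"
proof (rule ccontr)
  assume "d \<noteq> e"
  then consider "d \<in> {1..<e}" | "e \<in> {1..<d}" using assms(3,4) by force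
  then show False using assms(1,2) by cases (auto simp: primitive_roots_def)
qed

lemma roots_unity_eq_UN_primitive_roots:
  assumes "n > 0"
  shows "{z :: complex. z ^ n = 1} = (\<Union>d\<in>{d. d dvd n}. primitive_roots d)"
proof (intro equalityI subsetI)
  fix z :: complex assume "z \<in> {z. z ^ n = 1}"
  then have zn: "z ^ n = 1" by simp
  \<comment> \<open>The multiplicative order of \<open>z\<close>; the exponent \<open>n\<close>
    shows that it exists.\<close>
  define d where "d = (LEAST m. m > 0 \<and> z ^ m = 1)"
  have d: "d > 0" "z ^ d = 1"
    using LeastI[of "\<lambda>m. m > 0 \<and> z ^ m = 1" n] zn assms by (auto simp: d_def)
  have least: "z ^ m \<noteq> 1" if "0 < m" "m < d" for m
    using not_less_Least[of m "\<lambda>m. m > 0 \<and> z ^ m = 1"] that by (auto simp: d_def)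
  have "z ^ n = z ^ (d * (n div d) + n mod d)" by simp
  also have "\<dots> = z ^ (n mod d)" by (simp only: power_add power_mult d power_one mult_1)
  finally have "z ^ (n mod d) = 1" using zn by simp
  then have "n mod d = 0" using least[of "n mod d"] d(1) by fastforce
  then have "d dvd n" by auto
  moreover have "z \<in> primitive_roots d" using d least by (auto simp: primitive_roots_def)
  ultimately show "z \<in> (\<Union>d\<in>{d. d dvd n}. primitive_roots d)" by blast
next
  fix z :: complex assume "z \<in> (\<Union>d\<in>{d. d dvd n}. primitive_roots d)"
  then obtain d where "d dvd n" "z ^ d = 1" by (auto simp: primitive_roots_def)
  then show "z \<in> {z. z ^ n = 1}" by (auto simp: dvd_def power_mult)
qed

lemma prod_roots_unity:
  fixes h :: "complex \<Rightarrow> 'a::comm_monoid_mult"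
  assumes "n > 0"
  shows "(\<Prod>z | z ^ n = 1. h z) = (\<Prod>d | d dvd n. \<Prod>z\<in>primitive_roots d. h z)"
  unfolding roots_unity_eq_UN_primitive_roots[OF assms]
proof (rule prod.UNION_disjoint)
  show "finite {d. d dvd n}" using assms by simp
  show "\<forall>d\<in>{d. d dvd n}. finite (primitive_roots d)"
    using assms by (auto intro!: finite_primitive_roots dest: dvd_pos_nat)
  show "\<forall>d\<in>{d. d dvd n}. \<forall>e\<in>{d. d dvd n}. d \<noteq> e \<longrightarrow> primitive_roots d \<inter> primitive_roots e = {}"
    using primitive_roots_unique dvd_pos_nat[OF assms] by blast
qed

text \<open>Both functions have divisor sum \<open>n\<close>: the \<open>n\<close>th roots of unity
  are sorted by their order, and totients of divisors add up to \<open>n\<close>. Induction removes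
  the proper divisors from both sums.\<close>

lemma card_primitive_roots:
  assumes "n > 0"
  shows "card (primitive_roots n) = totient n"
  using assms
proof (induction n rule: less_induct)
  case (less n)
  have fin: "finite {d. d dvd n}" and pos: "\<And>d. d dvd n \<Longrightarrow> d > 0"
    using less.prems by (auto dest: dvd_pos_nat)
  have "(\<Sum>d | d dvd n. card (primitive_roots d)) = card {z :: complex. z ^ n = 1}"
    unfolding roots_unity_eq_UN_primitive_roots[OF less.prems]
    using fin pos primitive_roots_unique
    by (intro card_UN_disjoint[symmetric]) (auto intro!: finite_primitive_roots)
  also have "\<dots> = (\<Sum>d | d dvd n. totient d)"
    using less.prems by (simp add: card_roots_unity_eq totient_divisor_sum)
  finally have "(\<Sum>d | d dvd n. card (primitive_roots d)) = (\<Sum>d | d dvd n. totient d)" .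
  moreover have "(\<Sum>d\<in>{d. d dvd n} - {n}. card (primitive_roots d)) = (\<Sum>d\<in>{d. d dvd n} - {n}. totient d)"
  proof (rule sum.cong[OF refl])
    fix d assume "d \<in> {d. d dvd n} - {n}"
    then have "d < n" "d > 0" using dvd_imp_le[of d n] less.prems pos by auto
    then show "card (primitive_roots d) = totient d" by (rule less.IH)
  qed
  ultimately show ?case
    using sum.remove[OF fin, of n "\<lambda>d. card (primitive_roots d)"] sum.remove[OF fin, of n totient]
    by simp
qed

section \<open>Existence of the gamma expansion of cyclotomic polynomials\<close>

lemma degree_prod_linear_le: "degree (\<Prod>z\<in>Z. [:1, c z:]) \<le> card Z"
proof (induction Z rule: infinite_finite_induct)
  case (insert z Z)
  have "degree ([:1, c z:] * (\<Prod>z\<in>Z. [:1, c z:])) \<le> degree [:1, c z:] + degree (\<Prod>z\<in>Z. [:1, c z:])"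
    by (rule degree_mult_le)
  also have "\<dots> \<le> 1 + card Z" using insert.IH by (intro add_mono) simp_all
  finally show ?case using insert.hyps by (simp del: mult_pCons_left)
qed simp_all

text \<open>Evaluates the product of the \<open>[:1, c z:]\<close> at \<open>v / u^2\<close> and
  clears denominators. It is used with \<open>u = 1 + q\<close> and \<open>v = - q\<close>, where
  each factor is the contribution of a conjugate pair.\<close>

lemma prod_homogenize:
  fixes u v :: "'a::field"
  assumes "u \<noteq> 0"
  shows "(\<Prod>z\<in>Z. u\<^sup>2 + c z * v) =
    (\<Sum>j\<le>card Z. coeff (\<Prod>z\<in>Z. [:1, c z:]) j * u ^ (2 * card Z - 2 * j) * v ^ j)"
proof -
  let ?E = "\<Prod>z\<in>Z. [:1, c z:]"
  have "(\<Prod>z\<in>Z. u\<^sup>2 + c z * v) = (\<Prod>z\<in>Z. u\<^sup>2 * poly [:1, c z:] (v / u\<^sup>2))"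
    using assms by (intro prod.cong) (simp_all add: field_simps)
  also have "\<dots> = u ^ (2 * card Z) * poly ?E (v / u\<^sup>2)"
    by (simp add: prod.distrib poly_prod power_mult)
  also have "poly ?E (v / u\<^sup>2) = (\<Sum>j\<le>card Z. coeff ?E j * (v / u\<^sup>2) ^ j)"
    unfolding poly_altdef using degree_prod_linear_le[of c Z]
    by (intro sum.mono_neutral_left) (auto simp: coeff_eq_0)
  also have "u ^ (2 * card Z) * \<dots> = (\<Sum>j\<le>card Z. coeff ?E j * u ^ (2 * card Z - 2 * j) * v ^ j)"
    unfolding sum_distrib_left
  proof (intro sum.cong refl)
    fix j assume "j \<in> {..card Z}"
    then have "u ^ (2 * card Z) = u ^ (2 * card Z - 2 * j) * u ^ (2 * j)"
      by (simp flip: power_add)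
    then show "u ^ (2 * card Z) * (coeff ?E j * (v / u\<^sup>2) ^ j) =
        coeff ?E j * u ^ (2 * card Z - 2 * j) * v ^ j"
      using assms by (simp add: power_divide flip: power_mult)
  qed
  finally show ?thesis .
qed

text \<open>Allows identities to be checked away from the finitely many points where a substitution
  degenerates.\<close>

lemma poly_eqI_cofinite:
  fixes p q :: "'a::{idom, ring_char_0} poly"
  assumes "finite S" "\<And>x. x \<notin> S \<Longrightarrow> poly p x = poly q x"
  shows "p = q"
proof (rule ccontr)
  assume "p \<noteq> q"
  then have "finite {x. poly (p - q) x = 0}" by (intro poly_roots_finite) simp
  moreover have "UNIV \<subseteq> S \<union> {x. poly (p - q) x = 0}" using assms(2) by auto
  ultimately have "finite (UNIV :: 'a set)" using assms(1) by (meson finite_UnI finite_subset)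
  then show False by (simp add: infinite_UNIV_char_0)
qed

lemma primitive_roots_cnj: "z \<in> primitive_roots n \<Longrightarrow> cnj z \<in> primitive_roots n"
  by (simp add: primitive_roots_def flip: complex_cnj_power)

lemma primitive_roots_norm: "z \<in> primitive_roots n \<Longrightarrow> n > 0 \<Longrightarrow> cmod z = 1"
  using power_eq_1_iff[of z n] by (auto simp: primitive_roots_def)

lemma primitive_roots_Im_nonzero:
  assumes "z \<in> primitive_roots n" "n \<ge> 3"
  shows "Im z \<noteq> 0"
proof
  assume "Im z = 0"
  moreover have "(Re z)\<^sup>2 + (Im z)\<^sup>2 = 1"
    using primitive_roots_norm[OF assms(1)] assms(2) cmod_power2[of z] by simp
  ultimately have "z ^ 2 = 1" by (simp add: complex_eq_iff power2_eq_square)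
  then show False using assms by (auto simp: primitive_roots_def)
qed

lemma primitive_roots_2: "primitive_roots 2 = {-1}"
proof -
  have "{1..<2} = {1 :: nat}" by auto
  then have "primitive_roots 2 = {z. z\<^sup>2 = 1 \<and> z \<noteq> 1}" by (simp add: primitive_roots_def)
  also have "\<dots> = {-1}" using power2_eq_1_iff by fastforce
  finally show ?thesis .
qed

text \<open>The factor \<open>(-1) ^ j\<close> isolates the sign of the gamma coefficients, so that
  what remains is the nonnegative polynomial \<open>E\<close>. For \<open>n \<ge> 3\<close> it is
  the product of \<open>1 + (2 + 2 Re z) X\<close> over the primitive roots in the upper half
  plane.\<close>

lemma cyclotomic_expansion:
  assumes "n \<ge> 2"
  obtains E where "E \<in> coeffs_in (of_real ` {0..})" "coeff E 0 = 1"
    "degree E \<le> totient n div 2"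
    "cyclotomic n = (\<Sum>j\<le>totient n div 2.
       smult ((-1) ^ j * coeff E j) ([:0, 1:] ^ j * [:1, 1:] ^ (totient n - 2 * j)))"
proof (cases "n = 2")
  \<comment> \<open>The only primitive root is \<open>-1\<close>, which is real and so has no
    conjugate partner; here \<open>E = 1\<close>.\<close>
  case True
  have "1 \<in> coeffs_in (of_real ` {0..} :: complex set)"
    using subsemiring_coeffs_in[OF subsemiring_nonneg] unfolding subsemiring_def by blast
  moreover have "totient 2 = 1"
    using card_primitive_roots[of 2] by (simp add: primitive_roots_2)
  ultimately show thesis
    using True by (intro that[of 1]) (simp_all add: cyclotomic_def primitive_roots_2)
next
  case False
  then have n: "n \<ge> 3" using assms by simp
  define Z where "Z = {z \<in> primitive_roots n. Im z > 0}"
  have fin: "finite (primitive_roots n)" using n by (intro finite_primitive_roots) simp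
  have finZ: "finite Z" using fin by (simp add: Z_def)
  have split: "primitive_roots n = Z \<union> cnj ` Z"
  proof (intro equalityI subsetI)
    fix z assume z: "z \<in> primitive_roots n"
    show "z \<in> Z \<union> cnj ` Z"
    proof (cases "Im z > 0")
      case False
      then have "cnj z \<in> Z"
        using z primitive_roots_Im_nonzero[OF z n] by (auto simp: Z_def primitive_roots_cnj)
      then show ?thesis by (metis UnI2 complex_cnj_cnj image_eqI)
    qed (use z in \<open>simp add: Z_def\<close>)
  qed (auto simp: Z_def primitive_roots_cnj)
  have disj: "Z \<inter> cnj ` Z = {}" by (auto simp: Z_def)
  have inj: "inj_on cnj Z" by (auto simp: inj_on_def)
  have "card (primitive_roots n) = 2 * card Z"
    unfolding split using finZ disj by (simp add: card_Un_disjoint card_image[OF inj])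
  then have tot: "totient n = 2 * card Z" using card_primitive_roots[of n] n by simp
  define c :: "complex \<Rightarrow> complex" where "c z = of_real (2 + 2 * Re z)" for z
  define E where "E = (\<Prod>z\<in>Z. [:1, c z:])"
  show thesis
  proof
    show "E \<in> coeffs_in (of_real ` {0..})"
      unfolding E_def
    proof (rule subsemiring_prod[OF subsemiring_coeffs_in[OF subsemiring_nonneg]])
      fix z assume "z \<in> Z"
      then have "cmod z = 1" using primitive_roots_norm n by (auto simp: Z_def)
      \<comment> \<open>The source of all nonnegativity: \<open>2 + 2 Re z \<ge> 0\<close> on the
        unit circle.\<close>
      then have "Re z \<ge> -1" using abs_Re_le_cmod[of z] by simp
      then have "c z \<in> of_real ` {0..}" unfolding c_def by (intro imageI) simp
      moreover have "0 \<in> (of_real ` {0..} :: complex set)" "1 \<in> (of_real ` {0..} :: complex set)"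
        using subsemiring_nonneg[where 'a = complex] by (auto simp only: subsemiring_def)
      ultimately show "[:1, c z:] \<in> coeffs_in (of_real ` {0..})"
        by (simp add: coeffs_in_def coeff_pCons split: nat.split)
    qed
    show "coeff E 0 = 1" by (simp add: E_def flip: poly_0_coeff_0 add: poly_prod)
    show "degree E \<le> totient n div 2" using degree_prod_linear_le[of c Z] by (simp add: tot E_def)
    show "cyclotomic n = (\<Sum>j\<le>totient n div 2.
       smult ((-1) ^ j * coeff E j) ([:0, 1:] ^ j * [:1, 1:] ^ (totient n - 2 * j)))"
    \<comment> \<open>The point \<open>-1\<close> is excluded because the homogenization divides by
      \<open>1 + q\<close>.\<close>
    proof (rule poly_eqI_cofinite[of "{-1}"])
      fix q :: complex assume "q \<notin> {-1}"
      then have q: "1 + q \<noteq> 0" by (auto simp: add_eq_0_iff)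
      have "poly (cyclotomic n) q = (\<Prod>z\<in>Z. q - z) * (\<Prod>z\<in>Z. q - cnj z)"
        unfolding cyclotomic_def split
        by (subst prod.union_disjoint)
          (use finZ disj inj in \<open>auto simp: poly_prod prod.reindex\<close>)
      also have "\<dots> = (\<Prod>z\<in>Z. (1 + q)\<^sup>2 + c z * (- q))"
        unfolding prod.distrib[symmetric]
      proof (rule prod.cong[OF refl])
        fix z assume "z \<in> Z"
        then have "cmod z = 1" using primitive_roots_norm n by (auto simp: Z_def)
        then have "z * cnj z = 1" by (simp add: complex_norm_square[symmetric])
        moreover have "z + cnj z = of_real (2 * Re z)" by (rule complex_add_cnj)
        then have "c z = 2 + (z + cnj z)" by (simp add: c_def)
        ultimately show "(q - z) * (q - cnj z) = (1 + q)\<^sup>2 + c z * (- q)"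
          by algebra
      qed
      also have "\<dots> = (\<Sum>j\<le>card Z. coeff E j * (1 + q) ^ (2 * card Z - 2 * j) * (- q) ^ j)"
        unfolding E_def by (rule prod_homogenize[OF q])
      finally show "poly (cyclotomic n) q = poly (\<Sum>j\<le>totient n div 2.
          smult ((-1) ^ j * coeff E j) ([:0, 1:] ^ j * [:1, 1:] ^ (totient n - 2 * j))) q"
        by (simp add: poly_sum tot power_minus[of q] mult_ac)
    qed simp
  qed
qed

section \<open>Uniqueness of the gamma coefficients\<close>

lemma gamma_basis_independent:
  fixes \<delta> :: "nat \<Rightarrow> 'a::idom"
  assumes "(\<Sum>j\<le>m div 2. smult (\<delta> j) ([:0, 1:] ^ j * [:1, 1:] ^ (m - 2 * j))) = 0" "i \<le> m div 2"
  shows "\<delta> i = 0"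
  using assms(2)
proof (induction i rule: less_induct)
  case (less i)
  have X: "[:0, 1:] ^ j = monom (1::'a) j" for j by (simp add: monom_altdef)
  have "0 = coeff (\<Sum>j\<le>m div 2. smult (\<delta> j) ([:0, 1:] ^ j * [:1, 1:] ^ (m - 2 * j))) i"
    by (simp only: assms(1) coeff_0)
  \<comment> \<open>The family is triangular: the \<open>j\<close>th member starts with
    \<open>q^j\<close>, with coefficient 1. Terms with \<open>j > i\<close> do not reach degree
    \<open>i\<close>, and those with \<open>j < i\<close> vanish by induction.\<close>
  also have "\<dots> = (\<Sum>j\<le>m div 2. if j = i then \<delta> i else 0)"
    unfolding coeff_sum
  proof (intro sum.cong refl)
    fix j
    consider "j < i" | "j = i" | "i < j" by linarith
    then show "coeff (smult (\<delta> j) ([:0, 1:] ^ j * [:1, 1:] ^ (m - 2 * j))) i = (if j = i then \<delta> i else 0)"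
    proof cases
      case 1
      then show ?thesis using less by simp
    next
      case 2
      have "coeff ([:1, 1:] ^ k :: 'a poly) 0 = 1" for k by (simp add: coeff_0_power)
      with 2 show ?thesis by (simp add: X coeff_monom_mult)
    next
      case 3
      then show ?thesis by (simp add: X coeff_monom_mult)
    qed
  qed
  also have "\<dots> = \<delta> i" using less.prems by simp
  finally show ?case by simp
qed

lemma gamma_coeff_eqI:
  assumes "\<forall>j. totient n div 2 < j \<longrightarrow> \<gamma> j = 0"
    "cyclotomic n = (\<Sum>j\<le>totient n div 2. smult (\<gamma> j) ([:0, 1:] ^ j * [:1, 1:] ^ (totient n - 2 * j)))"
  shows "gamma_coeff n = \<gamma>"
  unfolding gamma_coeff_def
proof (rule the_equality)
  fix \<eta> :: "nat \<Rightarrow> complex"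
  assume \<eta>: "(\<forall>j. totient n div 2 < j \<longrightarrow> \<eta> j = 0) \<and>
    cyclotomic n = (\<Sum>j\<le>totient n div 2. smult (\<eta> j) ([:0, 1:] ^ j * [:1, 1:] ^ (totient n - 2 * j)))"
  then have "(\<Sum>j\<le>totient n div 2. smult (\<eta> j - \<gamma> j) ([:0, 1:] ^ j * [:1, 1:] ^ (totient n - 2 * j))) = 0"
    using assms(2) by (simp add: smult_diff_left sum_subtractf)
  from gamma_basis_independent[OF this] have "\<eta> j = \<gamma> j" for j
    using \<eta> assms(1) by (cases "j \<le> totient n div 2") auto
  then show "\<eta> = \<gamma>" by (rule ext)
qed (use assms in blast)

subsection \<open>Lucas atoms and their coefficients\<close>

text \<open>One polynomial \<open>E\<close> describes both objects: its coefficients carry signs in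
  \<open>cyclotomic n\<close> but none in \<open>lucas_atom n\<close>, where \<open>(-1) ^ j\<close>
  cancels against the sign of \<open>(- var_t) ^ j\<close>.\<close>

definition atom_coeffs :: "nat \<Rightarrow> complex poly \<Rightarrow> bool" where
  "atom_coeffs n E \<longleftrightarrow> E \<in> coeffs_in (of_real ` {0..}) \<and> coeff E 0 = 1 \<and>
     cyclotomic n = (\<Sum>j\<le>totient n div 2.
       smult ((-1) ^ j * coeff E j) ([:0, 1:] ^ j * [:1, 1:] ^ (totient n - 2 * j))) \<and>
     lucas_atom n = (\<Sum>j\<le>totient n div 2. monom (monom (coeff E j) j) (totient n - 2 * j))"

lemma smult_var_monomial: "smult [:c:] (var_s ^ i * var_t ^ j) = monom (monom c j) i"
proof -
  have "var_s ^ i = monom 1 i" by (simp add: var_s_def monom_altdef)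
  moreover have "var_t ^ j = monom (monom 1 j) 0"
    by (induction j) (simp_all add: var_t_def mult_monom monom_0 monom_Suc one_pCons)
  ultimately show ?thesis by (simp add: mult_monom smult_monom)
qed

lemma ex_atom_coeffs:
  assumes "n \<ge> 2"
  shows "\<exists>E. atom_coeffs n E"
proof -
  obtain E where E: "E \<in> coeffs_in (of_real ` {0..})" "coeff E 0 = 1" "degree E \<le> totient n div 2"
    "cyclotomic n = (\<Sum>j\<le>totient n div 2.
       smult ((-1) ^ j * coeff E j) ([:0, 1:] ^ j * [:1, 1:] ^ (totient n - 2 * j)))"
    using cyclotomic_expansion[OF assms] by blast
  have \<gamma>: "gamma_coeff n = (\<lambda>j. (-1) ^ j * coeff E j)"
    using E(3,4) by (intro gamma_coeff_eqI) (auto simp: coeff_eq_0)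
  have "smult [:(-1) ^ j * c:] (var_s ^ i * (- var_t) ^ j) = monom (monom c j) i" for c i j
  proof -
    have minus_one: "[:-1:] = (-1 :: complex poly)" by (simp add: one_pCons)
    have "(- var_t) ^ j = smult ([:(-1) ^ j:]) (var_t ^ j)"
      using minus_one by (cases "even j") (simp_all flip: one_pCons)
    then have "smult [:(-1) ^ j * c:] (var_s ^ i * (- var_t) ^ j) =
        smult ([:(-1) ^ j * c:] * [:(-1) ^ j:]) (var_s ^ i * var_t ^ j)"
      by (simp only: mult_smult_right smult_smult)
    also have "[:(-1) ^ j * c:] * [:(-1) ^ j:] = [:c:]" by simp
    finally show ?thesis by (simp only: smult_var_monomial)
  qed
  then have "lucas_atom n = (\<Sum>j\<le>totient n div 2. monom (monom (coeff E j) j) (totient n - 2 * j))"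
    using assms by (simp add: lucas_atom_def \<gamma>)
  with E show ?thesis unfolding atom_coeffs_def by blast
qed

lemma lucas_atom_nonneg:
  assumes "n \<ge> 2"
  shows "lucas_atom n \<in> coeffs_in (coeffs_in (of_real ` {0..}))"
proof -
  let ?R = "of_real ` {0..} :: complex set"
  obtain E where E: "atom_coeffs n E" using ex_atom_coeffs[OF assms] by blast
  have R: "subsemiring (coeffs_in ?R)" "subsemiring (coeffs_in (coeffs_in ?R))"
    by (intro subsemiring_coeffs_in subsemiring_nonneg)+
  have "monom (coeff E j) j \<in> coeffs_in ?R" for j
    using E by (intro monom_in_coeffs_in) (auto simp: atom_coeffs_def coeffs_in_def)
  moreover have "0 \<in> coeffs_in ?R" using R(1) by (simp add: subsemiring_def)
  ultimately have "monom (monom (coeff E j) j) i \<in> coeffs_in (coeffs_in ?R)" for i j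
    by (intro monom_in_coeffs_in[where R = "coeffs_in ?R"])
  then show ?thesis
    using E unfolding atom_coeffs_def by (auto intro!: subsemiring_sum[OF R(2)])
qed

text \<open>Only the term \<open>j = 0\<close> reaches degree \<open>totient n\<close> in
  \<open>s\<close>, and \<open>E\<close> has constant term 1.\<close>

lemma lucas_atom_monic:
  assumes "n \<ge> 2"
  shows "lead_coeff (lucas_atom n) = 1"
proof -
  obtain E where E: "atom_coeffs n E" using ex_atom_coeffs[OF assms] by blast
  have "coeff (lucas_atom n) i = (if i = totient n then 1 else 0)" if "i \<ge> totient n" for i
  proof -
    have "coeff (lucas_atom n) i =
        (\<Sum>j\<le>totient n div 2. if totient n - 2 * j = i then monom (coeff E j) j else 0)"
      using E by (simp add: atom_coeffs_def coeff_sum coeff_monom)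
    also have "\<dots> = (\<Sum>j\<le>totient n div 2. if j = 0 then (if i = totient n then 1 else 0) else 0)"
      using that E by (intro sum.cong) (auto simp: atom_coeffs_def)
    finally show ?thesis by simp
  qed
  then have "coeff (lucas_atom n) (totient n) = 1"
    and "\<And>i. i > totient n \<Longrightarrow> coeff (lucas_atom n) i = 0" by simp_all
  moreover from this have "degree (lucas_atom n) = totient n"
    by (intro antisym degree_le le_degree) auto
  ultimately show ?thesis by simp
qed

lemma lucas_atom_nonzero: "n \<ge> 2 \<Longrightarrow> lucas_atom n \<noteq> 0"
  using lucas_atom_monic by fastforce

subsection \<open>Evaluation and the atomic decomposition\<close>

definition bipoly_eval :: "complex \<Rightarrow> complex \<Rightarrow> bipoly \<Rightarrow> complex" where
  "bipoly_eval s t p = poly (poly p [:s:]) t"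

lemma bipoly_eval_simps [simp]:
  "bipoly_eval s t 0 = 0" "bipoly_eval s t 1 = 1"
  "bipoly_eval s t (p + q) = bipoly_eval s t p + bipoly_eval s t q"
  "bipoly_eval s t (p * q) = bipoly_eval s t p * bipoly_eval s t q"
  "bipoly_eval s t (prod h A) = (\<Prod>x\<in>A. bipoly_eval s t (h x))"
  "bipoly_eval s t (sum h A) = (\<Sum>x\<in>A. bipoly_eval s t (h x))"
  "bipoly_eval s t (monom (monom c j) i) = c * s ^ i * t ^ j"
  "bipoly_eval s t var_s = s" "bipoly_eval s t var_t = t"
  by (simp_all add: bipoly_eval_def poly_prod poly_sum poly_monom var_s_def var_t_def poly_power)

text \<open>Fixing only \<open>t\<close> leaves a polynomial in \<open>s\<close> over a field, to
  which facts on roots and their orders apply.\<close>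

definition specialize_t :: "complex \<Rightarrow> bipoly \<Rightarrow> complex poly" where
  "specialize_t t = map_poly (\<lambda>c. poly c t)"

lemma poly_specialize_t: "poly (specialize_t t p) s = bipoly_eval s t p"
  by (induction p) (simp_all add: specialize_t_def bipoly_eval_def map_poly_pCons)

lemma coeff_specialize_t: "coeff (specialize_t t p) i = poly (coeff p i) t"
  by (simp add: specialize_t_def coeff_map_poly)

lemma specialize_t_mult: "specialize_t t (p * q) = specialize_t t p * specialize_t t q"
  by (simp add: poly_eq_poly_eq_iff[symmetric] fun_eq_iff poly_specialize_t)

lemma specialize_t_1: "specialize_t t 1 = 1"
  by (simp add: poly_eq_poly_eq_iff[symmetric] fun_eq_iff poly_specialize_t)

text \<open>The pairs \<open>(x + y, - x * y)\<close> reach every \<open>(s, t)\<close> with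
  \<open>t \<noteq> 0\<close> and nonzero discriminant \<open>s^2 + 4 t\<close>. These suffice to
  compare first in \<open>s\<close> and then in \<open>t\<close>.\<close>

lemma bipoly_eqI:
  assumes "\<And>x y. x \<noteq> y \<Longrightarrow> y \<noteq> 0 \<Longrightarrow> bipoly_eval (x + y) (- x * y) p = bipoly_eval (x + y) (- x * y) q"
  shows "p = q"
proof -
  have "specialize_t t p = specialize_t t q" if "t \<noteq> 0" for t
  proof (rule poly_eqI_cofinite)
    have "[:4 * t, 0, 1:] \<noteq> 0" by simp
    then have "finite {s. poly [:4 * t, 0, 1:] s = 0}" by (rule poly_roots_finite)
    then show "finite {s. s\<^sup>2 + 4 * t = 0}" by (simp add: power2_eq_square add.commute)
    fix s assume "s \<notin> {s. s\<^sup>2 + 4 * t = 0}"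
    define r where "r = csqrt (s\<^sup>2 + 4 * t)"
    have r: "r\<^sup>2 = s\<^sup>2 + 4 * t" by (simp add: r_def)
    \<comment> \<open>The two roots of \<open>X^2 - s X - t\<close>.\<close>
    define x y where "x = (s + r) / 2" and "y = (s - r) / 2"
    have xy: "x + y = s" "x - y = r" by (simp_all add: x_def y_def field_simps)
    have t: "- x * y = t" using r by (simp add: x_def y_def field_simps power2_eq_square)
    have "r \<noteq> 0" using r \<open>s \<notin> _\<close> by auto
    then have "x \<noteq> y" using xy by auto
    moreover have "y \<noteq> 0" using t that by auto
    ultimately show "poly (specialize_t t p) s = poly (specialize_t t q) s"
      using assms[of x y, unfolded xy t] by (simp add: poly_specialize_t)
  qed
  then have "poly (coeff p i) t = poly (coeff q i) t" if "t \<notin> {0}" for i t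
    using that by (metis coeff_specialize_t singletonI)
  then have "coeff p i = coeff q i" for i
    by (intro poly_eqI_cofinite[of "{0}"]) auto
  then show ?thesis by (rule poly_eqI)
qed

text \<open>Binet's formula, multiplied out by \<open>x - y\<close>.\<close>

lemma bipoly_eval_lucas:
  "(x - y) * bipoly_eval (x + y) (- x * y) (lucas n) = x ^ n - y ^ n"
proof (induction n rule: lucas.induct)
  case (3 n)
  have "(x - y) * bipoly_eval (x + y) (- x * y) (lucas (Suc (Suc n))) =
      (x + y) * ((x - y) * bipoly_eval (x + y) (- x * y) (lucas (Suc n)))
      + (- x * y) * ((x - y) * bipoly_eval (x + y) (- x * y) (lucas n))"
    by (simp add: algebra_simps)
  also have "\<dots> = x ^ Suc (Suc n) - y ^ Suc (Suc n)"
    unfolding 3 by (simp add: algebra_simps)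
  finally show ?case .
qed simp_all

text \<open>The substitution turns the gamma expansion into the homogenized cyclotomic polynomial
  \<open>y ^ totient n * \<Phi>(x / y)\<close>.\<close>

lemma bipoly_eval_lucas_atom:
  assumes "n \<ge> 2" "y \<noteq> 0"
  shows "bipoly_eval (x + y) (- x * y) (lucas_atom n) = (\<Prod>z\<in>primitive_roots n. x - z * y)"
proof -
  obtain E where E: "atom_coeffs n E" using ex_atom_coeffs[OF assms(1)] by blast
  define q where "q = x / y"
  have x: "x = q * y" using assms(2) by (simp add: q_def)
  have "bipoly_eval (x + y) (- x * y) (lucas_atom n) =
      (\<Sum>j\<le>totient n div 2. coeff E j * (x + y) ^ (totient n - 2 * j) * (- x * y) ^ j)"
    using E by (simp add: atom_coeffs_def)
  also have "\<dots> = (\<Sum>j\<le>totient n div 2.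
      y ^ totient n * ((-1) ^ j * coeff E j * (q ^ j * (1 + q) ^ (totient n - 2 * j))))"
  proof (rule sum.cong[OF refl])
    fix j assume "j \<in> {..totient n div 2}"
    then have "totient n = (totient n - 2 * j) + 2 * j" by auto
    then have "y ^ totient n = y ^ (totient n - 2 * j) * (y\<^sup>2) ^ j"
      by (metis power_add power_mult)
    moreover have "(x + y) ^ m = (1 + q) ^ m * y ^ m" for m
      by (simp add: x algebra_simps flip: power_mult_distrib)
    moreover have "(- x * y) ^ j = (-1) ^ j * q ^ j * (y\<^sup>2) ^ j"
      by (simp add: x power2_eq_square mult_ac flip: power_mult_distrib)
    ultimately show "coeff E j * (x + y) ^ (totient n - 2 * j) * (- x * y) ^ j =
        y ^ totient n * ((-1) ^ j * coeff E j * (q ^ j * (1 + q) ^ (totient n - 2 * j)))"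
      by (simp only: mult_ac)
  qed
  also have "\<dots> = y ^ totient n * poly (cyclotomic n) q"
    using E by (simp add: atom_coeffs_def poly_sum sum_distrib_left)
  also have "\<dots> = (\<Prod>z\<in>primitive_roots n. y * (q - z))"
    using card_primitive_roots[of n] assms(1) by (simp add: cyclotomic_def poly_prod prod.distrib)
  also have "\<dots> = (\<Prod>z\<in>primitive_roots n. x - z * y)"
    by (simp add: x algebra_simps)
  finally show ?thesis .
qed

section \<open>Factoring \<open>{n}\<close> into atoms\<close>

lemma prod_roots_unity_diff:
  fixes x y :: complex
  assumes "n > 0" "y \<noteq> 0"
  shows "(\<Prod>z | z ^ n = 1. x - z * y) = x ^ n - y ^ n"
proof -
  let ?P = "\<Prod>z :: complex | z ^ n = 1. [:- z, 1:]" and ?Q = "monom 1 n - 1 :: complex poly"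
  have fin: "finite {z :: complex. z ^ n = 1}" using assms(1) by (intro finite_roots_unity) simp
  have card: "card {z :: complex. z ^ n = 1} = n" using assms(1) by (rule card_roots_unity_eq)
  have deg: "degree ?P = n" using card by (subst degree_prod_eq_sum_degree) simp_all
  \<comment> \<open>Both have degree at most \<open>n\<close>, agree at the \<open>n\<close> roots
    of unity and have the same coefficient at \<open>n\<close>.\<close>
  have "?P = ?Q"
  proof (rule poly_eqI_degree_lead_coeff)
    have "lead_coeff ?P = 1" by (simp add: lead_coeff_prod)
    then show "coeff ?P n = coeff ?Q n" using deg assms(1) by (simp add: coeff_1)
    show "degree ?Q \<le> n" by (intro degree_diff_le) (simp_all add: degree_monom_le)
    fix z :: complex assume "z \<in> {z. z ^ n = 1}"
    moreover from this have "poly ?P z = 0" using fin by (auto simp: poly_prod)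
    ultimately show "poly ?P z = poly ?Q z" by (simp add: poly_monom)
  qed (use deg card in simp_all)
  then have "poly ?P (x / y) = poly ?Q (x / y)" by simp
  then have "(\<Prod>z | z ^ n = 1. x / y - z) = (x / y) ^ n - 1"
    by (simp add: poly_prod poly_monom)
  then have "y ^ n * (\<Prod>z | z ^ n = 1. x / y - z) = x ^ n - y ^ n"
    using assms(2) by (simp add: power_divide right_diff_distrib)
  moreover have "y ^ n * (\<Prod>z | z ^ n = 1. x / y - z) = (\<Prod>z | z ^ n = 1. y * (x / y - z))"
    by (simp add: prod.distrib card)
  ultimately show ?thesis using assms(2) by (simp add: right_diff_distrib mult.commute)
qed

text \<open>The factors \<open>x - z * y\<close> of \<open>x ^ n - y ^ n\<close> are grouped by the
  order of \<open>z\<close>. The root \<open>z = 1\<close> supplies the factor \<open>x - y\<close>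
  from Binet's formula, which cancels.\<close>

lemma lucas_eq_prod_lucas_atom:
  assumes "n > 0"
  shows "lucas n = (\<Prod>d | 2 \<le> d \<and> d dvd n. lucas_atom d)"
proof (rule bipoly_eqI)
  fix x y :: complex assume xy: "x \<noteq> y" "y \<noteq> 0"
  have divisors: "{d. d dvd n} = insert 1 {d. 2 \<le> d \<and> d dvd n}"
    using dvd_pos_nat[OF assms] by (fastforce simp: numeral_2_eq_2 Suc_le_eq)
  have fin: "finite {d. 2 \<le> d \<and> d dvd n}"
    using assms by (intro finite_subset[OF _ finite_divisors_nat[OF assms]]) auto
  have one: "primitive_roots 1 = {1}" by (simp add: primitive_roots_def)
  have "(x - y) * bipoly_eval (x + y) (- x * y) (lucas n) = (\<Prod>z | z ^ n = 1. x - z * y)"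
    using prod_roots_unity_diff[OF assms xy(2)] by (simp only: bipoly_eval_lucas)
  also have "\<dots> = (\<Prod>d | d dvd n. \<Prod>z\<in>primitive_roots d. x - z * y)"
    by (rule prod_roots_unity[OF assms])
  also have "\<dots> = (x - y) * (\<Prod>d | 2 \<le> d \<and> d dvd n. \<Prod>z\<in>primitive_roots d. x - z * y)"
    unfolding divisors using fin one by simp
  also have "\<dots> = (x - y) * bipoly_eval (x + y) (- x * y) (\<Prod>d | 2 \<le> d \<and> d dvd n. lucas_atom d)"
    using bipoly_eval_lucas_atom[OF _ xy(2)] by (simp del: mult_minus_left)
  finally show "bipoly_eval (x + y) (- x * y) (lucas n) =
      bipoly_eval (x + y) (- x * y) (\<Prod>d | 2 \<le> d \<and> d dvd n. lucas_atom d)"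
    using xy by simp
qed

section \<open>Integrality and nonnegativity of the coefficients of atoms\<close>

lemma lucas_Ints: "lucas n \<in> coeffs_in (coeffs_in \<int>)"
proof -
  have R: "subsemiring (coeffs_in (coeffs_in (\<int> :: complex set)))"
    by (intro subsemiring_coeffs_in subsemiring_Ints)
  have "var_s \<in> coeffs_in (coeffs_in \<int>)" "var_t \<in> coeffs_in (coeffs_in \<int>)"
    by (auto simp: var_s_def var_t_def coeffs_in_def coeff_pCons split: nat.split)
  then show ?thesis
    using R by (induction n rule: lucas.induct) (auto simp: subsemiring_def)
qed

lemma lucas_atom_Ints:
  assumes "n \<ge> 2"
  shows "lucas_atom n \<in> coeffs_in (coeffs_in \<int>)"
  using assms
proof (induction n rule: less_induct)
  case (less n)
  \<comment> \<open>The cofactor of \<open>lucas_atom n\<close> in \<open>lucas n\<close>; it is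
    monic in \<open>s\<close>, and integral by induction.\<close>
  define B where "B = (\<Prod>d\<in>{d. 2 \<le> d \<and> d dvd n} - {n}. lucas_atom d)"
  have R: "subsemiring (coeffs_in (\<int> :: complex set))"
    "subsemiring (coeffs_in (coeffs_in (\<int> :: complex set)))"
    by (intro subsemiring_coeffs_in subsemiring_Ints)+
  have "finite {d. 2 \<le> d \<and> d dvd n}"
    using less.prems by (intro finite_subset[OF _ finite_divisors_nat[of n]]) auto
  then have "lucas n = lucas_atom n * B"
    using lucas_eq_prod_lucas_atom[of n] less.prems by (simp add: B_def prod.remove[of _ n])
  then have "B * lucas_atom n \<in> coeffs_in (coeffs_in \<int>)"
    using lucas_Ints[of n] by (simp add: mult.commute)
  moreover have "lead_coeff B = 1"
    unfolding B_def lead_coeff_prod by (intro prod.neutral) (simp add: lucas_atom_monic)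
  moreover have "B \<in> coeffs_in (coeffs_in \<int>)"
    unfolding B_def
  proof (rule subsemiring_prod[OF R(2)])
    fix d assume "d \<in> {d. 2 \<le> d \<and> d dvd n} - {n}"
    then have "d < n" "2 \<le> d" using dvd_imp_le[of d n] less.prems by auto
    then show "lucas_atom d \<in> coeffs_in (coeffs_in \<int>)" by (rule less.IH)
  qed
  moreover have "p - q \<in> coeffs_in \<int>" if "p \<in> coeffs_in \<int>" "q \<in> coeffs_in \<int>" for p q :: "complex poly"
    using that by (simp add: coeffs_in_def)
  ultimately show ?case
    using monic_quotient_coeffs_in[OF R(1)] by blast
qed

lemma lucas_atom_Nats:
  assumes "n \<ge> 2"
  shows "lucas_atom n \<in> coeffs_in (coeffs_in \<nat>)"
proof -
  have "z \<in> \<nat>" if "z \<in> \<int>" "z \<in> of_real ` {0..}" for z :: complex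
  proof -
    from that(1) obtain k where k: "z = of_int k" by (rule Ints_cases)
    then have "k \<ge> 0" using that(2) by (auto simp: complex_eq_iff)
    then have "z = of_nat (nat k)" using k by simp
    then show ?thesis by simp
  qed
  then show ?thesis
    using lucas_atom_Ints[OF assms] lucas_atom_nonneg[OF assms] unfolding coeffs_in_def by blast
qed

lemma prod_lucas_eq_prod_lucas_atom:
  assumes "finite I" "\<forall>i\<in>I. 0 < n i" "\<forall>d. a d = card {i \<in> I. d dvd n i}"
  shows "finite {d. 2 \<le> d \<and> a d \<noteq> 0}"
    and "(\<Prod>i\<in>I. lucas (n i)) = (\<Prod>d | 2 \<le> d \<and> a d \<noteq> 0. lucas_atom d ^ a d)"
proof -
  let ?D = "{d. 2 \<le> d \<and> a d \<noteq> 0}"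
  have "?D \<subseteq> (\<Union>i\<in>I. {d. d dvd n i})"
  proof
    fix d assume "d \<in> ?D"
    then have "{i \<in> I. d dvd n i} \<noteq> {}" using assms(3) by (metis (mono_tags) card.empty mem_Collect_eq)
    then show "d \<in> (\<Union>i\<in>I. {d. d dvd n i})" by blast
  qed
  moreover have "finite (\<Union>i\<in>I. {d. d dvd n i})" using assms by simp
  ultimately show fin: "finite ?D" by (rule finite_subset)
  \<comment> \<open>Padding with factors 1 gives all \<open>i\<close> the same index set
    \<open>?D\<close>, so the two products can be swapped; \<open>lucas_atom d\<close> then occurs
    \<open>a d\<close> times.\<close>
  have "(\<Prod>i\<in>I. lucas (n i)) = (\<Prod>i\<in>I. \<Prod>d\<in>?D. if d dvd n i then lucas_atom d else 1)"
  proof (rule prod.cong[OF refl])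
    fix i assume i: "i \<in> I"
    have "a d \<noteq> 0" if "d dvd n i" for d
      using assms(1,3) i that by auto
    then have "{d. 2 \<le> d \<and> d dvd n i} = {d \<in> ?D. d dvd n i}" by auto
    then show "lucas (n i) = (\<Prod>d\<in>?D. if d dvd n i then lucas_atom d else 1)"
      using lucas_eq_prod_lucas_atom[of "n i"] assms(2) i fin by (simp only: prod.inter_filter)
  qed
  also have "\<dots> = (\<Prod>d\<in>?D. \<Prod>i\<in>I. if d dvd n i then lucas_atom d else 1)"
    by (rule prod.swap)
  also have "\<dots> = (\<Prod>d\<in>?D. lucas_atom d ^ a d)"
    using assms by (simp add: prod.inter_filter[symmetric])
  finally show "(\<Prod>i\<in>I. lucas (n i)) = (\<Prod>d\<in>?D. lucas_atom d ^ a d)" .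
qed

subsection \<open>Exponents of atoms and the order of vanishing\<close>

lemma order_power:
  fixes p :: "'a::idom poly"
  assumes "p \<noteq> 0" shows "order c (p ^ m) = m * order c p"
  using assms by (induction m) (simp_all add: order_mult)

lemma order_prod:
  fixes h :: "'b \<Rightarrow> 'a::idom poly"
  assumes "finite A" "\<And>x. x \<in> A \<Longrightarrow> h x \<noteq> 0"
  shows "order c (prod h A) = (\<Sum>x\<in>A. order c (h x))"
  using assms by (induction A) (simp_all add: order_mult)

text \<open>With \<open>x = z\<close> and \<open>y = 1\<close> the atom takes the value of the
  \<open>e\<close>th cyclotomic polynomial at \<open>z\<close>.\<close>

lemma bipoly_eval_lucas_atom_eq_0_iff:
  assumes "e \<ge> 2" "d \<ge> 2" "z \<in> primitive_roots d"
  shows "bipoly_eval (z + 1) (- z) (lucas_atom e) = 0 \<longleftrightarrow> e = d"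
proof -
  have "bipoly_eval (z + 1) (- z) (lucas_atom e) = (\<Prod>w\<in>primitive_roots e. z - w)"
    using bipoly_eval_lucas_atom[OF assms(1), of 1 z] by simp
  then have "bipoly_eval (z + 1) (- z) (lucas_atom e) = 0 \<longleftrightarrow> z \<in> primitive_roots e"
    using finite_primitive_roots[of e] assms(1) by auto
  then show ?thesis using primitive_roots_unique[of z e d] assms by auto
qed

text \<open>After setting \<open>t = - z\<close>, the order at \<open>s = z + 1\<close> is additive
  over products and ignores every atom except \<open>lucas_atom d\<close>, which contributes
  \<open>k > 0\<close> per occurrence. Hence \<open>b d * k \<le> a d * k\<close>.\<close>

lemma lucas_atom_exponent_le:
  assumes "finite A" "finite B" "\<forall>d\<in>A \<union> B. 2 \<le> d"
    and eq: "(\<Prod>d\<in>A. lucas_atom d ^ a d) = h * (\<Prod>d\<in>B. lucas_atom d ^ b d)"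
    and "\<forall>d. d \<notin> A \<longrightarrow> a d = 0" "d \<in> B"
  shows "b d \<le> a d"
proof -
  have d: "d \<ge> 2" using assms by blast
  have "primitive_roots d \<noteq> {}"
    using card_primitive_roots[of d] d by force
  then obtain z where z: "z \<in> primitive_roots d" by blast
  define \<sigma> where "\<sigma> = specialize_t (- z)"
  define k where "k = order (z + 1) (\<sigma> (lucas_atom d))"
  have power: "\<sigma> (p ^ m) = \<sigma> p ^ m" for p m
    by (induction m) (simp_all add: \<sigma>_def specialize_t_1 specialize_t_mult)
  have prod: "\<sigma> (prod g D) = (\<Prod>x\<in>D. \<sigma> (g x))" for g :: "nat \<Rightarrow> bipoly" and D
    by (induction D rule: infinite_finite_induct) (simp_all add: \<sigma>_def specialize_t_1 specialize_t_mult)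
  \<comment> \<open>Being monic in \<open>s\<close>, an atom keeps its leading coefficient 1 when
    \<open>t\<close> is specialized.\<close>
  have nonzero: "\<sigma> (lucas_atom e) \<noteq> 0" if "e \<ge> 2" for e
  proof
    assume "\<sigma> (lucas_atom e) = 0"
    then have "poly (lead_coeff (lucas_atom e)) (- z) = 0"
      by (metis \<sigma>_def coeff_0 coeff_specialize_t)
    then show False using that by (simp add: lucas_atom_monic)
  qed
  have order_atom: "order (z + 1) (\<sigma> (lucas_atom e)) = (if e = d then k else 0)" if "e \<ge> 2" for e
    using bipoly_eval_lucas_atom_eq_0_iff[OF that d z]
    by (auto simp: k_def \<sigma>_def poly_specialize_t intro!: order_0I)
  have order_atoms: "order (z + 1) (\<sigma> (\<Prod>e\<in>D. lucas_atom e ^ m e)) = (if d \<in> D then m d * k else 0)"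
    if "finite D" "\<forall>e\<in>D. 2 \<le> e" for D m
  proof -
    have "order (z + 1) (\<sigma> (\<Prod>e\<in>D. lucas_atom e ^ m e)) = (\<Sum>e\<in>D. m e * (if e = d then k else 0))"
      using that nonzero order_atom by (simp add: prod power order_prod order_power)
    also have "\<dots> = (\<Sum>e\<in>D. if e = d then m d * k else 0)" by (intro sum.cong) auto
    finally show ?thesis using that by simp
  qed
  have "k > 0"
    using bipoly_eval_lucas_atom_eq_0_iff[OF d d z] nonzero[OF d]
      order_root[of "\<sigma> (lucas_atom d)" "z + 1"] by (simp add: k_def \<sigma>_def poly_specialize_t)
  have A: "order (z + 1) (\<sigma> (\<Prod>e\<in>A. lucas_atom e ^ a e)) = a d * k"
    using order_atoms[of A a] assms(1,3,5) by auto
  have B: "order (z + 1) (\<sigma> (\<Prod>e\<in>B. lucas_atom e ^ b e)) = b d * k"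
    using order_atoms[of B b] assms(2,3,6) by auto
  \<comment> \<open>Rules out that \<open>h\<close> specializes to zero, so that orders add on the
    right-hand side.\<close>
  have "\<sigma> (\<Prod>e\<in>A. lucas_atom e ^ a e) \<noteq> 0"
    using assms(1,3) nonzero by (simp add: prod power)
  then have "order (z + 1) (\<sigma> (\<Prod>e\<in>A. lucas_atom e ^ a e)) =
      order (z + 1) (\<sigma> h) + order (z + 1) (\<sigma> (\<Prod>e\<in>B. lucas_atom e ^ b e))"
    unfolding eq by (simp add: \<sigma>_def specialize_t_mult order_mult)
  then have "b d * k \<le> a d * k"
    unfolding A B by simp
  with \<open>k > 0\<close> show ?thesis by simp
qed

theorem theorem1p1:
  fixes r u :: nat and n k a b :: "nat \<Rightarrow> nat" and f g :: bipoly
  assumes n_pos: "\<forall>i\<in>{1..r}. 0 < n i"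
    and k_pos: "\<forall>j\<in>{1..u}. 0 < k j"
    and f_eq: "f = (\<Prod>i=1..r. lucas (n i))"
    and g_eq: "g = (\<Prod>j=1..u. lucas (k j))"
    and a_eq: "\<forall>d. a d = card {i \<in> {1..r}. d dvd n i}"
    and b_eq: "\<forall>d. b d = card {j \<in> {1..u}. d dvd k j}"
  shows "f = (\<Prod>d | 2 \<le> d \<and> a d \<noteq> 0. lucas_atom d ^ a d)
    \<and> g = (\<Prod>d | 2 \<le> d \<and> b d \<noteq> 0. lucas_atom d ^ b d)
    \<and> ((\<exists>h. to_fract f / to_fract g = to_fract h) \<longleftrightarrow> (\<forall>d\<ge>2. b d \<le> a d))
    \<and> ((\<forall>d\<ge>2. b d \<le> a d) \<longrightarrow>
         (\<exists>h. nonneg_integer_coeffs h \<and> to_fract f / to_fract g = to_fract h))"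
proof -
  let ?A = "{d. 2 \<le> d \<and> a d \<noteq> 0}" and ?B = "{d. 2 \<le> d \<and> b d \<noteq> 0}"
  note A = prod_lucas_eq_prod_lucas_atom[OF finite_atLeastAtMost n_pos a_eq]
  note B = prod_lucas_eq_prod_lucas_atom[OF finite_atLeastAtMost k_pos b_eq]
  have f: "f = (\<Prod>d\<in>?A. lucas_atom d ^ a d)" using f_eq A(2) by simp
  have g: "g = (\<Prod>d\<in>?B. lucas_atom d ^ b d)" using g_eq B(2) by simp
  have "g \<noteq> 0" unfolding g using B(1) by (simp add: lucas_atom_nonzero)
  then have quotient: "to_fract f / to_fract g = to_fract h \<longleftrightarrow> f = h * g" for h
    by (simp add: field_simps flip: to_fract_mult)
  have only_if: "\<forall>d\<ge>2. b d \<le> a d" if "f = h * g" for h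
  proof (intro allI impI)
    fix d :: nat assume "d \<ge> 2"
    \<comment> \<open>The exponents are cut off outside \<open>?A\<close>, since
      \<open>a 1 = r\<close> may be nonzero.\<close>
    define a' where "a' e = (if e \<in> ?A then a e else 0)" for e
    have "(\<Prod>e\<in>?A. lucas_atom e ^ a' e) = h * (\<Prod>e\<in>?B. lucas_atom e ^ b e)"
      using that unfolding f g by (simp add: a'_def)
    then have "b d \<le> a' d" if "d \<in> ?B"
      using A(1) B(1) that by (intro lucas_atom_exponent_le[of ?A ?B]) (auto simp: a'_def)
    then show "b d \<le> a d" using \<open>d \<ge> 2\<close> by (cases "b d = 0") (auto simp: a'_def split: if_splits)
  qed
  have "if": "\<exists>h. nonneg_integer_coeffs h \<and> f = h * g" if le: "\<forall>d\<ge>2. b d \<le> a d"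
  proof -
    \<comment> \<open>The truncated differences are exact because \<open>b d \<le> a d\<close> on
      \<open>?A\<close>.\<close>
    define h where "h = (\<Prod>d\<in>?A. lucas_atom d ^ (a d - b d))"
    \<comment> \<open>The inequality gives \<open>?B \<subseteq> ?A\<close>, and the added factors
      have exponent 0.\<close>
    have "g = (\<Prod>d\<in>?A. lucas_atom d ^ b d)"
      unfolding g
    proof (intro prod.mono_neutral_left A(1) ballI subsetI)
      fix d assume "d \<in> ?B"
      then show "d \<in> ?A" using le by fastforce
    qed auto
    then have "f = h * g"
      unfolding f h_def using le by (simp flip: prod.distrib power_add)
    moreover have N: "subsemiring (coeffs_in (coeffs_in (\<nat> :: complex set)))"
      by (intro subsemiring_coeffs_in subsemiring_Nats)
    have "h \<in> coeffs_in (coeffs_in \<nat>)"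
      unfolding h_def
      by (intro subsemiring_prod[OF N] subsemiring_power[OF N] lucas_atom_Nats) simp
    then have "nonneg_integer_coeffs h"
      by (simp add: nonneg_integer_coeffs_def coeffs_in_def)
    ultimately show ?thesis by blast
  qed
  show ?thesis
    using f g only_if "if" unfolding quotient by blast
qed

end
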